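(* Let $K$ be a field of characteristic zero, $R=K[x,y,z]$ with the standard grading, and let $a,b,c,\beta,\gamma$ be integers with $a\geq c\geq 2$, $1\leq \beta\leq b-1$ and $\max\{1,b-a+1\}\leq \gamma\leq \min\{b-1,c-1\}$. Consider the ideal $$I=(x^a,\ y^b-x^{b-\gamma}z^\gamma,\ z^c,\ x^{a-b+\gamma}y^{b-\beta},\ y^{b-\beta}z^{c-\gamma})\subset R.$$ If $\max\{1,b+c-a-1\}\leq \beta\leq b-1$ and $\gamma\geq \left\lfloor\frac{\beta-a+b+c-2}{2}\right\rfloor$, then $R/I$ has the weak Lefschetz property.
   Context: A graded Artinian $K$-algebra $A=\bigoplus_i [A]_i$ has the weak Lefschetz property (WLP) if there exists a linear form $L\in[A]_1$ such that the multiplication map $\times L:[A]_i\to[A]_{i+1}$ has maximal rank (i.e. is injective or surjective) for every $i$. *)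

theory Defs
  imports Main "HOL-Library.Poly_Mapping" "HOL-Library.Product_Plus"
begin

text \<open>The polynomial ring K[x,y,z]: finitely supported maps from exponent
  triples (i,j,k) (the monomial x^i y^j z^k) to coefficients in K.\<close>
type_synonym 'a poly3 = "(nat \<times> nat \<times> nat) \<Rightarrow>\<^sub>0 'a"

definition varX :: "'a::comm_ring_1 poly3" where "varX = Poly_Mapping.single (1,0,0) 1"
definition varY :: "'a::comm_ring_1 poly3" where "varY = Poly_Mapping.single (0,1,0) 1"
definition varZ :: "'a::comm_ring_1 poly3" where "varZ = Poly_Mapping.single (0,0,1) 1"

definition homog :: "nat \<Rightarrow> 'a::comm_ring_1 poly3 \<Rightarrow> bool" where
  "homog d p \<longleftrightarrow> (\<forall>(i,j,k) \<in> Poly_Mapping.keys p. i + j + k = d)"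

definition ideal_gen :: "'a::comm_ring_1 poly3 list \<Rightarrow> 'a poly3 set" where
  "ideal_gen gs = {p. \<exists>f. p = (\<Sum>i<length gs. f i * gs ! i)}"

text \<open>For a homogeneous ideal I, [R/I]_d = [R]_d / (I \<inter> [R]_d). The map
  \<times>L : [R/I]_d \<rightarrow> [R/I]_(d+1) is injective iff L f \<in> I forces f \<in> I for f \<in> [R]_d,
  and surjective iff every g \<in> [R]_(d+1) is congruent mod I to some L f, f \<in> [R]_d.\<close>
definition mult_injective :: "'a::comm_ring_1 poly3 set \<Rightarrow> 'a poly3 \<Rightarrow> nat \<Rightarrow> bool" where
  "mult_injective I L d \<longleftrightarrow> (\<forall>f. homog d f \<and> L * f \<in> I \<longrightarrow> f \<in> I)"

definition mult_surjective :: "'a::comm_ring_1 poly3 set \<Rightarrow> 'a poly3 \<Rightarrow> nat \<Rightarrow> bool" where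
  "mult_surjective I L d \<longleftrightarrow> (\<forall>g. homog (Suc d) g \<longrightarrow> (\<exists>f. homog d f \<and> g - L * f \<in> I))"

definition has_WLP :: "'a::comm_ring_1 poly3 set \<Rightarrow> bool" where
  "has_WLP I \<longleftrightarrow> (\<exists>L. homog 1 L \<and>
      (\<forall>d. mult_injective I L d \<or> mult_surjective I L d))"

end

theory Submission
  imports Defs
begin

text \<open>
  Put \<open>u = b - \<gamma>\<close>, \<open>v = a - u\<close>, \<open>g = \<gamma>\<close>, \<open>e = c - \<gamma>\<close>, \<open>p = b - \<beta>\<close> and let
  \<open>J = (y^(u+g) - x^u z^g, z^(g+e), y^p z^e)\<close>, so that \<open>I = J + (x^(u+v), x^v y^p)\<close>.
  Rewriting \<open>y^(u+g)\<close> to \<open>x^u z^g\<close> gives a monomial normal form modulo \<open>J\<close> that is compatible with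
  multiplication by \<open>x\<close>, hence \<open>x\<close> is a nonzerodivisor on \<open>R/J\<close>; as \<open>y + z\<close> is nilpotent there,
  \<open>L = x - y - z\<close> is a nonzerodivisor as well.
  The quotient \<open>R/(J, L)\<close> vanishes in all degrees that are at least \<open>p + g + e - 1\<close> and exceed
  \<open>T = u + g + e - 2\<close>. If \<open>T \<ge> p + g + e - 1\<close>, its degree \<open>T\<close> part is spanned by
  \<open>y^(u+g-1) z^(e-1)\<close>. Eliminating \<open>x\<close> by \<open>x = y + z\<close> and rewriting \<open>y^(u+g)\<close> never produces a
  negative coefficient, so in characteristic zero \<open>x^(T-p) y^p\<close> has a nonzero coefficient
  at this monomial.
  The hypotheses say \<open>p + g + e \<le> u + v + 1\<close> and \<open>T \<le> v + p + 1\<close>.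
  If \<open>2 (d + 1) \<le> T + v + p\<close>, then in degree \<open>d + 1\<close> the ideal \<open>I\<close> differs from \<open>J\<close> at most by
  multiples of \<open>x^v y^p\<close>, which is not in \<open>(J, L)\<close> when \<open>d + 1 = v + p\<close>, so multiplication by
  \<open>L\<close> is injective on degree \<open>d\<close>. Otherwise \<open>R/(J, L)\<close> vanishes in degree \<open>d + 1\<close>, or
  \<open>d + 1 = T\<close> and \<open>x^v y^p\<close> divides the spanning element \<open>x^(T-p) y^p\<close>, so multiplication is
  surjective.
\<close>

section \<open>Linear maps on polynomials, given on monomials\<close>

lemma poly_mapping_single_add_induct [case_names single add]:
  assumes single: "\<And>m c. P (Poly_Mapping.single m c)"
    and add: "\<And>f g. P f \<Longrightarrow> P g \<Longrightarrow> P (f + g)"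
  shows "P (f :: 'b \<Rightarrow>\<^sub>0 'a::comm_monoid_add)"
proof (induction f rule: update_induct)
  case const
  show ?case using single[of undefined 0] by simp
next
  case (update f a b)
  have "Poly_Mapping.update a b f = Poly_Mapping.single a b + f"
    by (rule poly_mapping_eqI)
      (use update(1) in \<open>auto simp: lookup_update lookup_add lookup_single in_keys_iff when_def\<close>)
  then show ?case using add single update by simp
qed

text \<open>Values are polynomials rather than scalars, so that normal forms and coefficient
  functionals (with constant values) are both instances.\<close>

definition lin_ext ::
  "('b \<Rightarrow> ('b::comm_monoid_add \<Rightarrow>\<^sub>0 'a)) \<Rightarrow> ('b \<Rightarrow>\<^sub>0 'a::comm_ring_1) \<Rightarrow> ('b \<Rightarrow>\<^sub>0 'a)" where
  "lin_ext N f = (\<Sum>m\<in>Poly_Mapping.keys f. Poly_Mapping.single 0 (Poly_Mapping.lookup f m) * N m)"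

lemma lin_ext_single [simp]: "lin_ext N (Poly_Mapping.single m c) = Poly_Mapping.single 0 c * N m"
  by (simp add: lin_ext_def)

lemma lin_ext_add: "lin_ext N (f + g) = lin_ext N f + lin_ext N g"
  unfolding lin_ext_def
  by (rule setsum_keys_plus_distrib) (simp_all add: single_add distrib_right)

lemma lin_ext_0 [simp]: "lin_ext N 0 = 0"
  by (simp add: lin_ext_def)

lemma lin_ext_uminus: "lin_ext N (- f) = - lin_ext N f"
  by (metis add_eq_0_iff add.right_inverse lin_ext_0 lin_ext_add)

lemma lin_ext_diff: "lin_ext N (f - g) = lin_ext N f - lin_ext N g"
  by (metis diff_conv_add_uminus lin_ext_add lin_ext_uminus)

lemma lin_ext_cong:
  assumes "\<And>m. m \<in> Poly_Mapping.keys f \<Longrightarrow> N m = N' m"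
  shows "lin_ext N f = lin_ext N' f"
  unfolding lin_ext_def using assms by (intro sum.cong) auto

lemma lin_ext_zero_fun [simp]: "lin_ext (\<lambda>m. 0) f = 0"
  by (simp add: lin_ext_def)

lemma lin_ext_scale: "lin_ext N (Poly_Mapping.single 0 c * f) = Poly_Mapping.single 0 c * lin_ext N f"
proof (induction f rule: poly_mapping_single_add_induct)
  case (single m d)
  show ?case by (simp add: mult_single flip: mult.assoc)
next
  case (add f g)
  then show ?case by (simp add: lin_ext_add distrib_left)
qed

text \<open>By linearity in \<open>f\<close>; a check on all multiples of \<open>h\<close> thereby
  reduces to monomial multiples.\<close>

lemma lin_ext_mult:
  "lin_ext N (f * h) = lin_ext (\<lambda>m. lin_ext N (Poly_Mapping.single m 1 * h)) f"
proof (induction f rule: poly_mapping_single_add_induct)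
  case (single m c)
  have "Poly_Mapping.single m c * h = Poly_Mapping.single 0 c * (Poly_Mapping.single m 1 * h)"
    by (simp add: mult_single flip: mult.assoc)
  then show ?case by (simp only: lin_ext_scale lin_ext_single)
next
  case (add f g)
  then show ?case by (simp add: lin_ext_add distrib_right)
qed

lemma lin_ext_mult_eq_0:
  "(\<And>m. lin_ext N (Poly_Mapping.single m 1 * h) = 0) \<Longrightarrow> lin_ext N (f * h) = 0"
  by (subst lin_ext_mult) simp

lemma lin_ext_mult_left: "lin_ext (\<lambda>m. h * N m) f = h * lin_ext N f"
  by (simp add: lin_ext_def sum_distrib_left mult.left_commute)

lemma lin_ext_monomials: "lin_ext (\<lambda>m. Poly_Mapping.single m 1) f = f"
  by (induction f rule: poly_mapping_single_add_induct) (simp_all add: lin_ext_add mult_single)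

lemma lin_ext_at_zero:
  "lin_ext (\<lambda>m. if m = 0 then h else 0) f = Poly_Mapping.single 0 (Poly_Mapping.lookup f 0) * h"
  by (induction f rule: poly_mapping_single_add_induct)
    (simp_all add: lin_ext_add lookup_add single_add distrib_right lookup_single when_def)

lemma lookup_single_mult:
  fixes m :: "'b::cancel_comm_monoid_add"
    and f :: "'b \<Rightarrow>\<^sub>0 'a::comm_ring_1"
  shows "Poly_Mapping.lookup (Poly_Mapping.single m 1 * f) (m + n) = Poly_Mapping.lookup f n"
  by (induction f rule: poly_mapping_single_add_induct)
    (simp_all add: distrib_left lookup_add mult_single lookup_single when_def)

lemma single_mult_eq_0_iff:
  fixes m :: "'b::cancel_comm_monoid_add"
  shows "Poly_Mapping.single m 1 * f = 0 \<longleftrightarrow> (f :: 'b \<Rightarrow>\<^sub>0 'a::comm_ring_1) = 0"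
proof
  assume "Poly_Mapping.single m 1 * f = 0"
  then show "f = 0"
    by (intro poly_mapping_eqI) (metis lookup_single_mult lookup_zero)
qed simp

section \<open>Finitely generated ideals\<close>

lemma ideal_gen_add: "f \<in> ideal_gen gs \<Longrightarrow> h \<in> ideal_gen gs \<Longrightarrow> f + h \<in> ideal_gen gs"
  unfolding ideal_gen_def
  by clarsimp (metis (mono_tags, lifting) distrib_right sum.cong sum.distrib)

lemma ideal_gen_mult: "f \<in> ideal_gen gs \<Longrightarrow> h * f \<in> ideal_gen gs"
  unfolding ideal_gen_def
  by clarsimp (metis (mono_tags, lifting) mult.assoc sum.cong sum_distrib_left)

lemma ideal_gen_0: "0 \<in> ideal_gen gs"
  unfolding ideal_gen_def by (auto intro!: exI[of _ "\<lambda>_. 0"])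

lemma ideal_gen_sum: "(\<And>i. i \<in> S \<Longrightarrow> f i \<in> ideal_gen gs) \<Longrightarrow> sum f S \<in> ideal_gen gs"
  by (induction S rule: infinite_finite_induct) (auto simp: ideal_gen_0 ideal_gen_add)

lemma ideal_gen_generator:
  assumes "h \<in> set gs" shows "h \<in> ideal_gen gs"
proof -
  obtain n where n: "n < length gs" "gs ! n = h"
    using assms by (auto simp: in_set_conv_nth)
  have "h = (\<Sum>i<length gs. (if i = n then 1 else 0) * gs ! i)"
    using n by (simp add: if_distrib[of "\<lambda>x. x * _"] cong: if_cong)
  then show ?thesis unfolding ideal_gen_def by (intro CollectI exI)
qed

lemma ideal_gen_mono:
  assumes "set gs \<subseteq> set hs" shows "ideal_gen gs \<subseteq> ideal_gen hs"
proof
  fix f assume "f \<in> ideal_gen gs"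
  then obtain c where "f = (\<Sum>i<length gs. c i * gs ! i)" by (auto simp: ideal_gen_def)
  then show "f \<in> ideal_gen hs"
    using assms by (auto intro!: ideal_gen_sum ideal_gen_mult[OF ideal_gen_generator])
qed

section \<open>Monomials, degrees and the linear form\<close>

abbreviation mon :: "nat \<Rightarrow> nat \<Rightarrow> nat \<Rightarrow> 'a::comm_ring_1 poly3" where
  "mon i j k \<equiv> Poly_Mapping.single (i, j, k) 1"

lemma triple_eq_0_iff: "(i, j, k) = (0 :: nat \<times> nat \<times> nat) \<longleftrightarrow> i = 0 \<and> j = 0 \<and> k = 0"
  by (simp add: zero_prod_def)

lemma varX_power: "varX ^ n = mon n 0 0"
  by (induction n) (simp_all add: varX_def mult_single zero_prod_def flip: single_one)

lemma varY_power: "varY ^ n = mon 0 n 0"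
  by (induction n) (simp_all add: varY_def mult_single zero_prod_def flip: single_one)

lemma varZ_power: "varZ ^ n = mon 0 0 n"
  by (induction n) (simp_all add: varZ_def mult_single zero_prod_def flip: single_one)

lemma mon_power: "mon i j k ^ n = mon (n * i) (n * j) (n * k)"
  by (induction n) (simp_all add: mult_single zero_prod_def flip: single_one)

lemma homog_add: "homog d f \<Longrightarrow> homog d h \<Longrightarrow> homog d (f + h)"
  unfolding homog_def using keys_add[of f h] by fast

lemma homog_mult: "homog m f \<Longrightarrow> homog n h \<Longrightarrow> homog (m + n) (f * h)"
  unfolding homog_def using keys_mult[of f h] by fastforce

lemma homog_scale: "homog d f \<Longrightarrow> homog d (Poly_Mapping.single 0 c * f)"
  using homog_mult[of 0 "Poly_Mapping.single 0 c" d f] by (simp add: homog_def zero_prod_def)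

lemma homog_mon: "i + j + k = d \<Longrightarrow> homog d (mon i j k)"
  by (simp add: homog_def)

definition ell :: "'a::comm_ring_1 poly3" where
  "ell = mon 1 0 0 - (mon 0 1 0 + mon 0 0 1)"

lemma ell_mult_mon: "ell * mon i j k = mon (Suc i) j k - (mon i (Suc j) k + mon i j (Suc k))"
  by (simp add: ell_def algebra_simps mult_single)

lemma homog_ell: "homog 1 ell"
  unfolding homog_def ell_def
  using keys_diff[of "mon 1 0 0" "mon 0 1 0 + mon 0 0 1"] keys_add[of "mon 0 1 0" "mon 0 0 1"]
  by fastforce


section \<open>The image of multiplication by \<open>ell\<close> modulo an ideal\<close>

definition ell_reach :: "'a::comm_ring_1 poly3 set \<Rightarrow> nat \<Rightarrow> 'a poly3 set" where
  "ell_reach I d = {h. \<exists>f. homog d f \<and> h - ell * f \<in> I}"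

lemma ell_reach_mono: "I \<subseteq> I' \<Longrightarrow> ell_reach I d \<subseteq> ell_reach I' d"
  by (auto simp: ell_reach_def)

lemma ell_reach_add:
  assumes "f \<in> ell_reach (ideal_gen gs) d" "h \<in> ell_reach (ideal_gen gs) d"
  shows "f + h \<in> ell_reach (ideal_gen gs) d"
proof -
  obtain f' h' where "homog d f'" "f - ell * f' \<in> ideal_gen gs"
    and "homog d h'" "h - ell * h' \<in> ideal_gen gs"
    using assms by (auto simp: ell_reach_def)
  then have "homog d (f' + h')" "(f - ell * f') + (h - ell * h') \<in> ideal_gen gs"
    by (simp_all only: homog_add ideal_gen_add)
  then show ?thesis
    unfolding ell_reach_def by (intro CollectI exI[of _ "f' + h'"]) (simp add: algebra_simps)
qed

lemma ell_reach_scale: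
  assumes "f \<in> ell_reach (ideal_gen gs) d"
  shows "Poly_Mapping.single 0 c * f \<in> ell_reach (ideal_gen gs) d"
proof -
  let ?c = "Poly_Mapping.single 0 c"
  obtain f' where "homog d f'" "f - ell * f' \<in> ideal_gen gs"
    using assms by (auto simp: ell_reach_def)
  then have "homog d (?c * f')" "?c * (f - ell * f') \<in> ideal_gen gs"
    by (simp_all only: homog_scale ideal_gen_mult)
  then show ?thesis
    unfolding ell_reach_def by (intro CollectI exI[of _ "?c * f'"]) (simp add: algebra_simps)
qed

lemma ell_reach_ideal: "f \<in> I \<Longrightarrow> f \<in> ell_reach I d"
  by (auto simp: ell_reach_def homog_def intro!: exI[of _ 0])

lemma ell_reach_diff:
  assumes "f \<in> ell_reach (ideal_gen gs) d" "h \<in> ell_reach (ideal_gen gs) d"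
  shows "f - h \<in> ell_reach (ideal_gen gs) d"
  using ell_reach_add[OF assms(1) ell_reach_scale[OF assms(2), of "- 1"]] by (simp add: single_uminus)

lemma ell_reach_ell_mult: "homog d f \<Longrightarrow> ell * f \<in> ell_reach (ideal_gen gs) d"
  by (auto simp: ell_reach_def ideal_gen_0)

lemma mult_surjective_if_monomials:
  assumes "\<And>i j k. i + j + k = Suc d \<Longrightarrow> mon i j k \<in> ell_reach (ideal_gen gs) d"
  shows "mult_surjective (ideal_gen gs) ell d"
proof -
  have "h \<in> ell_reach (ideal_gen gs) d" if "homog (Suc d) h" for h
  proof -
    have "(\<Sum>m\<in>S. Poly_Mapping.single 0 (Poly_Mapping.lookup h m) * Poly_Mapping.single m 1)
            \<in> ell_reach (ideal_gen gs) d"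
      if "S \<subseteq> Poly_Mapping.keys h" for S
      using finite_subset[OF that finite_keys] that
    proof (induction S rule: finite_induct)
      case empty
      show ?case by (simp add: ell_reach_ideal ideal_gen_0)
    next
      case (insert m S)
      then have "Poly_Mapping.single m 1 \<in> ell_reach (ideal_gen gs) d"
        using \<open>homog (Suc d) h\<close> assms by (cases m) (auto simp: homog_def)
      with insert show ?case by (simp add: ell_reach_add ell_reach_scale)
    qed
    from this[OF order_refl] show ?thesis
      by (simp only: lin_ext_monomials flip: lin_ext_def)
  qed
  then show ?thesis by (auto simp: mult_surjective_def ell_reach_def)
qed

section \<open>The coefficient functional on the top degree\<close>

text \<open>The coefficient of \<open>x^i y^j z^k\<close> at the top monomial \<open>y^(u+g-1) z^(e-1)\<close> of \<open>R/(J, L)\<close>;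
  the guard \<open>0 < g\<close> only serves termination.\<close>
function top_coeff :: "nat \<Rightarrow> nat \<Rightarrow> nat \<Rightarrow> nat \<Rightarrow> nat \<Rightarrow> nat \<Rightarrow> nat" where
  "top_coeff u g e (Suc i) j k = top_coeff u g e i (Suc j) k + top_coeff u g e i j (Suc k)"
| "top_coeff u g e 0 j k =
    (if 0 < g \<and> u + g \<le> j then top_coeff u g e u (j - (u + g)) (k + g)
     else if Suc j = u + g \<and> Suc k = e then 1 else 0)"
  by pat_completeness auto
termination
  \<comment> \<open>Trading x for y keeps \<open>i + j\<close> and lowers \<open>i\<close>; trading
    x for z lowers \<open>i + j\<close> by 1, and rewriting y^(u+g) lowers it by
    \<open>g\<close>.\<close>
  by (relation "(\<lambda>(u, g, e, i, j, k). i + j) <*mlex*> measure (\<lambda>(u, g, e, i, j, k). i)")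
    (auto simp: mlex_prod_def)

declare top_coeff.simps(2) [simp del]

lemma top_coeff_degree: "top_coeff u g e i j k \<noteq> 0 \<Longrightarrow> i + j + k + 2 = u + g + e"
  by (induction u g e i j k rule: top_coeff.induct)
    (force simp: top_coeff.simps(2) split: if_splits)+

lemma top_coeff_y_power:
  "0 < g \<Longrightarrow> top_coeff u g e i (j + (u + g)) k = top_coeff u g e (i + u) j (k + g)"
proof (induction i arbitrary: j k)
  case 0
  then show ?case by (simp add: top_coeff.simps(2))
next
  case (Suc i)
  then show ?case using Suc.IH[of "Suc j" k] Suc.IH[of j "Suc k"] by simp
qed

lemma top_coeff_z_power: "g + e \<le> k \<Longrightarrow> top_coeff u g e i j k = 0"
  by (induction u g e i j k rule: top_coeff.induct) (auto simp: top_coeff.simps(2))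

text \<open>Expanding x keeps both bounds, and rewriting y^(u+g) lifts the z-exponent to at least
  \<open>g + e\<close>, where \<open>top_coeff_z_power\<close> applies.\<close>

lemma top_coeff_y_z_power:
  "p \<le> j \<Longrightarrow> e \<le> k \<Longrightarrow> top_coeff u g e i j k = 0"
  by (induction u g e i j k rule: top_coeff.induct)
    (auto simp: top_coeff.simps(2) intro: top_coeff_z_power)

text \<open>Natural numbers cannot cancel, so one surviving branch suffices: raise \<open>j\<close>
  to \<open>u + g - 1\<close>, then \<open>k\<close> to \<open>e - 1\<close>.\<close>

lemma top_coeff_pos:
  "i + j + k + 2 = u + g + e \<Longrightarrow> j < u + g \<Longrightarrow> k < e \<Longrightarrow> 0 < top_coeff u g e i j k"
proof (induction i arbitrary: j k)
  case 0
  then show ?case by (auto simp: top_coeff.simps(2))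
next
  case (Suc i)
  show ?case
  proof (cases "Suc j < u + g")
    case True
    then show ?thesis using Suc.IH[of "Suc j" k] Suc.prems by simp
  next
    case False
    then show ?thesis using Suc.IH[of j "Suc k"] Suc.prems by simp
  qed
qed

section \<open>The ideals J and I, and normal forms modulo J\<close>

locale exponents =
  fixes u v g e p :: nat
  assumes pos: "0 < u" "0 < v" "0 < g" "0 < e" "0 < p" and p_less: "p < u + g"
begin

definition J_gens :: "'a::field_char_0 poly3 list" where
  "J_gens = [mon 0 (u + g) 0 - mon u 0 g, mon 0 0 (g + e), mon 0 p e]"

definition I_gens :: "'a::field_char_0 poly3 list" where
  "I_gens = [mon (u + v) 0 0, mon 0 (u + g) 0 - mon u 0 g, mon 0 0 (g + e), mon v p 0, mon 0 p e]"

lemma J_subset_I: "ideal_gen J_gens \<subseteq> ideal_gen I_gens"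
  by (rule ideal_gen_mono) (auto simp: J_gens_def I_gens_def)

text \<open>The conditions on \<open>W\<close> say that it respects each monomial multiple of the
  three generators.\<close>

lemma lin_ext_J_eq_0:
  fixes W :: "nat \<times> nat \<times> nat \<Rightarrow> 'a::field_char_0 poly3"
  assumes "\<And>i j k. W (i, j + (u + g), k) = W (i + u, j, k + g)"
    and "\<And>i j k. W (i, j, k + (g + e)) = 0"
    and "\<And>i j k. W (i, j + p, k + e) = 0"
    and f: "f \<in> ideal_gen J_gens"
  shows "lin_ext W f = 0"
proof -
  obtain c where "f = (\<Sum>i<length (J_gens :: 'a poly3 list). c i * J_gens ! i)"
    using f by (auto simp: ideal_gen_def)
  then have "f = c 0 * (mon 0 (u + g) 0 - mon u 0 g) + c 1 * mon 0 0 (g + e) + c 2 * mon 0 p e"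
    by (simp add: J_gens_def eval_nat_numeral)
  moreover have "lin_ext W (c 0 * (mon 0 (u + g) 0 - mon u 0 g)) = 0"
    by (rule lin_ext_mult_eq_0)
      (simp add: right_diff_distrib lin_ext_diff mult_single split_paired_all assms(1))
  moreover have "lin_ext W (c 1 * mon 0 0 (g + e)) = 0"
    by (rule lin_ext_mult_eq_0) (simp add: mult_single split_paired_all assms(2))
  moreover have "lin_ext W (c 2 * mon 0 p e) = 0"
    by (rule lin_ext_mult_eq_0) (simp add: mult_single split_paired_all assms(3))
  ultimately show ?thesis by (simp add: lin_ext_add)
qed

text \<open>Here \<open>q\<close> counts the possible rewritings of y^(u+g) to x^u z^g; the result
  is kept if neither z^(g+e) nor y^p z^e divides it.\<close>

definition nf :: "nat \<times> nat \<times> nat \<Rightarrow> 'a::field_char_0 poly3" where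
  "nf = (\<lambda>(i, j, k). let q = j div (u + g); r = j mod (u + g); l = k + g * q in
     if l < g + e \<and> (r < p \<or> l < e) then mon (i + u * q) r l else 0)"

lemma nf_y_power: "nf (i, j + (u + g), k) = nf (i + u, j, k + g)"
  using pos by (auto simp: nf_def Let_def div_add_self2 add.assoc)

lemma nf_z_power: "nf (i, j, k + (g + e)) = 0"
  by (simp add: nf_def Let_def)

text \<open>The overlap of two rules: if y^(u+g) divides the monomial, one rewriting already
  produces z^(g+e).\<close>

lemma nf_y_z_power: "nf (i, j + p, k + e) = 0"
proof (cases "(j + p) div (u + g)")
  case 0
  then have "p \<le> (j + p) mod (u + g)"
    using pos by (auto simp: div_eq_0_iff)
  then show ?thesis using 0 by (simp add: nf_def Let_def)
next
  case (Suc q)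
  then show ?thesis by (simp add: nf_def Let_def)
qed

lemma nf_x: "nf (i + n, j, k) = mon n 0 0 * nf (i, j, k)"
  by (auto simp: nf_def Let_def mult_single add_ac)

lemma y_power_congruence:
  "mon i (j + q * (u + g)) k - mon (i + u * q) j (k + g * q) \<in> ideal_gen J_gens"
proof -
  let ?y = "mon 0 (u + g) 0" and ?x = "mon u 0 g"
  have "?y - ?x \<in> ideal_gen J_gens"
    by (rule ideal_gen_generator) (simp add: J_gens_def)
  \<comment> \<open>The cofactor telescopes \<open>?y - ?x\<close> into
    \<open>?y ^ q - ?x ^ q\<close>.\<close>
  then have "(mon i j k * (\<Sum>i<q. ?x ^ (q - Suc i) * ?y ^ i)) * (?y - ?x) \<in> ideal_gen J_gens"
    by (rule ideal_gen_mult)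
  then have "(?y ^ q - ?x ^ q) * mon i j k \<in> ideal_gen J_gens"
    unfolding power_diff_sumr2 by (simp only: mult_ac)
  then have "mon (q * 0 + i) (q * (u + g) + j) (q * 0 + k) - mon (q * u + i) (q * 0 + j) (q * g + k)
      \<in> ideal_gen J_gens"
    by (simp only: mon_power left_diff_distrib mult_single add_Pair mult_1)
  then show ?thesis by (simp add: add.commute mult.commute)
qed

lemma mon_z_in_J: "g + e \<le> k \<Longrightarrow> mon i j k \<in> ideal_gen J_gens"
  using ideal_gen_mult[OF ideal_gen_generator[of "mon 0 0 (g + e)" J_gens], of "mon i j (k - (g + e))"]
  by (simp add: J_gens_def mult_single)

lemma mon_y_z_in_J: "p \<le> j \<Longrightarrow> e \<le> k \<Longrightarrow> mon i j k \<in> ideal_gen J_gens"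
  using ideal_gen_mult[OF ideal_gen_generator[of "mon 0 p e" J_gens], of "mon i (j - p) (k - e)"]
  by (simp add: J_gens_def mult_single)

lemma mon_minus_nf: "mon i j k - nf (i, j, k) \<in> ideal_gen J_gens"
proof -
  let ?q = "j div (u + g)" and ?r = "j mod (u + g)"
  have *: "mon i j k - mon (i + u * ?q) ?r (k + g * ?q) \<in> ideal_gen J_gens"
    using y_power_congruence[of i ?r ?q k] by (simp only: mod_div_mult_eq)
  show ?thesis
  proof (cases "k + g * ?q < g + e \<and> (?r < p \<or> k + g * ?q < e)")
    case True
    then show ?thesis using * by (simp add: nf_def Let_def)
  next
    case False
    then have "mon (i + u * ?q) ?r (k + g * ?q) \<in> ideal_gen J_gens"
      using mon_z_in_J[of "k + g * ?q" "i + u * ?q" ?r] mon_y_z_in_J[of ?r "k + g * ?q" "i + u * ?q"]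
      by force
    from ideal_gen_add[OF * this] False show ?thesis by (auto simp: nf_def Let_def)
  qed
qed

lemma mem_J_iff: "f \<in> ideal_gen J_gens \<longleftrightarrow> lin_ext nf f = 0"
proof
  assume "f \<in> ideal_gen J_gens"
  then show "lin_ext nf f = 0"
    by (intro lin_ext_J_eq_0 nf_y_power nf_z_power nf_y_z_power)
next
  assume *: "lin_ext nf f = 0"
  have "f - lin_ext nf f = lin_ext (\<lambda>m. Poly_Mapping.single m 1) f - lin_ext nf f"
    by (simp add: lin_ext_monomials)
  also have "\<dots> = (\<Sum>m\<in>Poly_Mapping.keys f.
      Poly_Mapping.single 0 (Poly_Mapping.lookup f m) * (Poly_Mapping.single m 1 - nf m))"
    by (simp add: lin_ext_def right_diff_distrib sum_subtractf)
  also have "\<dots> \<in> ideal_gen J_gens"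
    by (intro ideal_gen_sum ideal_gen_mult) (auto intro: mon_minus_nf)
  finally show "f \<in> ideal_gen J_gens" using * by simp
qed

section \<open>Nonzerodivisors modulo J\<close>

lemma x_power_nonzerodivisor:
  assumes "mon n 0 0 * f \<in> ideal_gen J_gens"
  shows "f \<in> ideal_gen J_gens"
proof -
  have "lin_ext nf (mon n 0 0 * f) = lin_ext (\<lambda>m. lin_ext nf (Poly_Mapping.single m 1 * mon n 0 0)) f"
    by (subst mult.commute) (rule lin_ext_mult)
  also have "\<dots> = lin_ext (\<lambda>m. mon n 0 0 * nf m) f"
    by (rule lin_ext_cong) (auto simp: mult_single nf_x)
  finally show ?thesis
    using assms by (simp add: mem_J_iff lin_ext_mult_left single_mult_eq_0_iff)
qed

lemma y_plus_z_nilpotent: "\<exists>n. (mon 0 1 0 + mon 0 0 1) ^ n \<in> ideal_gen J_gens"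
proof -
  \<comment> \<open>Either y admits \<open>g + e\<close> rewritings, each adding \<open>g\<close> to
    the z-exponent, or that exponent exceeds \<open>g + e\<close> from the start.\<close>
  let ?B = "(u + g) * (g + e)"
  let ?n = "?B + (g + e)"
  have mem: "mon 0 j (?n - j) \<in> ideal_gen J_gens" if "j \<le> ?n" for j
  proof (cases "?B \<le> j")
    case True
    have "mon 0 j (?n - j) - mon (u * (g + e)) (j - ?B) (?n - j + g * (g + e)) \<in> ideal_gen J_gens"
      using y_power_congruence[of 0 "j - ?B" "g + e" "?n - j"] True by (simp add: mult.commute)
    moreover have "mon (u * (g + e)) (j - ?B) (?n - j + g * (g + e)) \<in> ideal_gen J_gens"
      using pos by (intro mon_z_in_J) (simp add: trans_le_add2)
    ultimately show ?thesis using ideal_gen_add by fastforce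
  next
    case False
    then show ?thesis by (intro mon_z_in_J) simp
  qed
  have "(mon 0 1 0 + mon 0 0 1) ^ ?n = (\<Sum>j\<le>?n. of_nat (?n choose j) * mon 0 j (?n - j))"
    unfolding binomial_ring by (simp add: mon_power mult_single mult.assoc)
  also have "\<dots> \<in> ideal_gen J_gens"
    by (intro ideal_gen_sum ideal_gen_mult mem) simp
  finally show ?thesis by blast
qed

text \<open>With w = y + z, \<open>ell\<close> divides x^n - w^n. Once w^n is in J,
  \<open>ell * f\<close> in J forces x^n f into J.\<close>

lemma ell_nonzerodivisor:
  fixes f :: "'a::field_char_0 poly3"
  assumes "ell * f \<in> ideal_gen J_gens"
  shows "f \<in> ideal_gen J_gens"
proof -
  let ?w = "mon 0 1 0 + mon 0 0 1 :: 'a poly3"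
  obtain n where n: "?w ^ n \<in> ideal_gen J_gens"
    using y_plus_z_nilpotent by blast
  have "(mon 1 0 0 ^ n - ?w ^ n) * f = (\<Sum>i<n. ?w ^ (n - Suc i) * mon 1 0 0 ^ i) * (ell * f)"
    unfolding power_diff_sumr2 ell_def by (simp only: mult_ac)
  then have "(mon 1 0 0 ^ n - ?w ^ n) * f \<in> ideal_gen J_gens"
    using ideal_gen_mult[OF assms] by simp
  then have "mon 1 0 0 ^ n * f - f * ?w ^ n \<in> ideal_gen J_gens"
    by (simp only: left_diff_distrib mult.commute[of f])
  from ideal_gen_add[OF this ideal_gen_mult[OF n, of f]]
  have "mon n 0 0 * f \<in> ideal_gen J_gens" by (simp add: mon_power)
  then show ?thesis by (rule x_power_nonzerodivisor)
qed

section \<open>Surjectivity in high degrees\<close>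

text \<open>The nested induction, on \<open>i + j\<close> and then on the x-exponent, follows the
  recursion of \<open>top_coeff\<close>.\<close>

lemma mon_congruent_top:
  assumes "i + j + k = Suc d" "u + g + e \<le> d + 3" "p + g + e \<le> d + 2"
  shows "mon i j k - of_nat (top_coeff u g e i j k) * mon 0 (u + g - 1) (e - 1)
    \<in> ell_reach (ideal_gen (J_gens :: 'a::field_char_0 poly3 list)) d"
  using assms(1)
proof (induction "i + j" arbitrary: i j k rule: less_induct)
  case less
  let ?w = "mon 0 (u + g - 1) (e - 1) :: 'a poly3"
  have "\<forall>j' k'. i' + j' = i + j \<longrightarrow> i' + j' + k' = Suc d \<longrightarrow>
     mon i' j' k' - of_nat (top_coeff u g e i' j' k') * ?w
      \<in> ell_reach (ideal_gen J_gens) d" for i'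
  proof (induction i')
    case 0
    show ?case
    proof (intro allI impI)
      fix j' k' assume *: "0 + j' = i + j" "0 + j' + k' = Suc d"
      consider "u + g \<le> j'" | "Suc j' = u + g" "Suc k' = e"
        | "j' < u + g" "\<not> (Suc j' = u + g \<and> Suc k' = e)" by linarith
      then show "mon 0 j' k' - of_nat (top_coeff u g e 0 j' k') * ?w
          \<in> ell_reach (ideal_gen J_gens) d"
      proof cases
        case 1
        have "mon 0 j' k' - mon u (j' - (u + g)) (k' + g) \<in> ideal_gen J_gens"
          using y_power_congruence[of 0 "j' - (u + g)" 1 k'] 1 by simp
        moreover have "mon u (j' - (u + g)) (k' + g)
            - of_nat (top_coeff u g e u (j' - (u + g)) (k' + g)) * ?w
            \<in> ell_reach (ideal_gen J_gens) d"
          using 1 * pos by (intro less(1)) auto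
        ultimately show ?thesis
          using ell_reach_add[OF ell_reach_ideal] pos 1 by (fastforce simp: top_coeff.simps(2))
      next
        case 2
        then have "j' = u + g - 1" "k' = e - 1" by auto
        then show ?thesis
          using 2 by (simp add: top_coeff.simps(2) ell_reach_ideal ideal_gen_0)
      next
        case 3
        \<comment> \<open>The degree bounds force \<open>k' \<ge> g + e\<close> if
          \<open>j' < p\<close>, and \<open>k' \<ge> e\<close> otherwise, since the top monomial is
          excluded.\<close>
        have "mon 0 j' k' \<in> ideal_gen (J_gens :: 'a poly3 list)"
        proof (cases "j' < p")
          case True
          then show ?thesis using * assms by (intro mon_z_in_J) auto
        next
          case False
          then show ?thesis using * 3 assms by (intro mon_y_z_in_J) auto
        qed
        then show ?thesis using 3 by (auto simp: top_coeff.simps(2) ell_reach_ideal)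
      qed
    qed
  next
    case (Suc i')
    show ?case
    proof (intro allI impI)
      fix j' k' assume *: "Suc i' + j' = i + j" "Suc i' + j' + k' = Suc d"
      let ?t = "\<lambda>i j k. of_nat (top_coeff u g e i j k)"
      have "mon i' (Suc j') k' - ?t i' (Suc j') k' * ?w \<in> ell_reach (ideal_gen J_gens) d"
        using Suc * by simp
      moreover have "mon i' j' (Suc k') - ?t i' j' (Suc k') * ?w \<in> ell_reach (ideal_gen J_gens) d"
        using * by (intro less(1)) auto
      moreover have "ell * mon i' j' k' \<in> ell_reach (ideal_gen J_gens) d"
        using * by (intro ell_reach_ell_mult homog_mon) auto
      ultimately have "ell * mon i' j' k' + ((mon i' (Suc j') k' - ?t i' (Suc j') k' * ?w)
          + (mon i' j' (Suc k') - ?t i' j' (Suc k') * ?w)) \<in> ell_reach (ideal_gen J_gens) d"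
        by (intro ell_reach_add)
      then show "mon (Suc i') j' k' - ?t (Suc i') j' k' * ?w \<in> ell_reach (ideal_gen J_gens) d"
        by (simp add: ell_mult_mon algebra_simps)
    qed
  qed
  then show ?case using less by blast
qed

lemma surjective_I:
  assumes H1: "p + g + e \<le> u + v + 1" and H2: "u + g + e \<le> v + p + 3"
    and d: "u + g + e + v + p < 2 * Suc d + 2"
  shows "mult_surjective (ideal_gen (I_gens :: 'a::field_char_0 poly3 list)) ell d"
proof (rule mult_surjective_if_monomials)
  fix i j k assume ijk: "i + j + k = Suc d"
  let ?I = "ideal_gen (I_gens :: 'a poly3 list)" and ?w = "mon 0 (u + g - 1) (e - 1) :: 'a poly3"
  have cong: "mon i j k - of_nat (top_coeff u g e i j k) * ?w \<in> ell_reach ?I d"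
    if "i + j + k = Suc d" for i j k
    \<comment> \<open>With \<open>d\<close>, \<open>H2\<close> gives
      \<open>u + g + e \<le> d + 3\<close> and \<open>H1\<close> gives
      \<open>p + g + e \<le> d + 2\<close>.\<close>
    using mon_congruent_top[OF that] ell_reach_mono[OF J_subset_I] H1 H2 d by fastforce
  show "mon i j k \<in> ell_reach ?I d"
  proof (cases "top_coeff u g e i j k = 0")
    case True
    then show ?thesis using cong[OF ijk] by simp
  next
    case False
    then have T: "Suc d + 2 = u + g + e" using top_coeff_degree ijk by metis
    \<comment> \<open>The monomial x^A y^p has top degree and lies in I; its coefficient
      \<open>t\<close> is invertible in characteristic zero, so the top monomial is reached.\<close>
    define A where "A = Suc d - p"
    have A: "A + p = Suc d" "v \<le> A" using T d by (auto simp: A_def)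
    define t where "t = top_coeff u g e A p 0"
    have "0 < t" unfolding t_def using T A p_less pos by (intro top_coeff_pos) auto
    have "mon (A - v) 0 0 * mon v p 0 \<in> ?I"
      by (intro ideal_gen_mult ideal_gen_generator) (simp add: I_gens_def)
    then have "mon A p 0 \<in> ell_reach ?I d"
      using A by (simp add: mult_single ell_reach_ideal)
    from ell_reach_diff[OF this cong[of A p 0]] have "of_nat t * ?w \<in> ell_reach ?I d"
      using A by (simp add: t_def)
    then have "Poly_Mapping.single 0 (of_nat (top_coeff u g e i j k) / of_nat t) * (of_nat t * ?w)
        \<in> ell_reach ?I d"
      by (rule ell_reach_scale)
    moreover have "Poly_Mapping.single 0 (of_nat (top_coeff u g e i j k) / of_nat t) * (of_nat t * ?w)
        = of_nat (top_coeff u g e i j k) * ?w"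
      using \<open>0 < t\<close> by (simp add: mult_single flip: single_of_nat)
    ultimately show ?thesis using ell_reach_add[OF cong[OF ijk]] by fastforce
  qed
qed

section \<open>Injectivity in low degrees\<close>

lemma I_decomp:
  fixes h :: "'a::field_char_0 poly3"
  assumes "h \<in> ideal_gen I_gens"
  obtains c0 c3 r where "h = c0 * mon (u + v) 0 0 + c3 * mon v p 0 + r" "r \<in> ideal_gen J_gens"
proof -
  obtain c where "h = (\<Sum>i<length (I_gens :: 'a poly3 list). c i * I_gens ! i)"
    using assms by (auto simp: ideal_gen_def)
  then have "h = c 0 * mon (u + v) 0 0 + c 3 * mon v p 0
      + (c 1 * (mon 0 (u + g) 0 - mon u 0 g) + c 2 * mon 0 0 (g + e) + c 4 * mon 0 p e)"
    by (simp add: I_gens_def eval_nat_numeral)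
  moreover have "c 1 * (mon 0 (u + g) 0 - mon u 0 g) + c 2 * mon 0 0 (g + e) + c 4 * mon 0 p e
      \<in> ideal_gen J_gens"
    by (intro ideal_gen_add ideal_gen_mult ideal_gen_generator) (simp_all add: J_gens_def)
  ultimately show ?thesis by (rule that)
qed

lemma injective_I:
  assumes H1: "p + g + e \<le> u + v + 1" and H2: "u + g + e \<le> v + p + 3"
    and d: "2 * Suc d + 2 \<le> u + g + e + v + p"
  shows "mult_injective (ideal_gen (I_gens :: 'a::field_char_0 poly3 list)) ell d"
  unfolding mult_injective_def
proof (intro allI impI)
  fix f :: "'a poly3" assume f: "homog d f \<and> ell * f \<in> ideal_gen I_gens"
  obtain c0 c3 r where dec: "ell * f = c0 * mon (u + v) 0 0 + c3 * mon v p 0 + r"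
    and r: "r \<in> ideal_gen J_gens"
    using I_decomp[OF conjunct2[OF f]] .
  have c3: "Poly_Mapping.lookup c3 0 = 0" if vp: "Suc d = v + p"
  proof -
    \<comment> \<open>Multiplying by x^s lifts degree \<open>v + p\<close> to the top degree, where
      \<open>top_coeff\<close> detects x^v y^p.\<close>
    define s where "s = u + g + e - 2 - (v + p)"
    have s: "s + v + p + 2 = u + g + e" using vp d by (auto simp: s_def)
    define W :: "nat \<times> nat \<times> nat \<Rightarrow> 'a poly3"
      where "W = (\<lambda>(i, j, k). of_nat (top_coeff u g e (i + s) j k))"
    have "lin_ext W r = 0"
    proof (rule lin_ext_J_eq_0[OF _ _ _ r])
      show "W (i, j + (u + g), k) = W (i + u, j, k + g)" for i j k
        using top_coeff_y_power[of g u e "i + s" j k] pos by (simp add: W_def add_ac)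
    qed (simp_all add: W_def top_coeff_z_power top_coeff_y_z_power[of p])
    moreover have "lin_ext W (c0 * mon (u + v) 0 0) = 0"
    proof -
      \<comment> \<open>Here \<open>H1\<close>, \<open>d\<close> and \<open>vp\<close> give
        \<open>p < u\<close>, so x^(u+v+s) exceeds the top degree \<open>v + p + s\<close>.\<close>
      have "top_coeff u g e (i + (u + v) + s) j k = 0" for i j k
        using top_coeff_degree[of u g e "i + (u + v) + s" j k] s H1 H2 d vp by linarith
      then show ?thesis
        by - (rule lin_ext_mult_eq_0, simp add: mult_single split_paired_all W_def)
    qed
    \<comment> \<open>The first equation of \<open>top_coeff\<close> says exactly that
      \<open>W\<close> vanishes on \<open>ell\<close> times a monomial.\<close>
    moreover have "lin_ext W (ell * f) = 0"
      unfolding mult.commute[of ell]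
      by (rule lin_ext_mult_eq_0, subst mult.commute)
        (simp add: split_paired_all ell_mult_mon lin_ext_diff lin_ext_add W_def)
    moreover have "lin_ext W (c3 * mon v p 0)
        = Poly_Mapping.single 0 (Poly_Mapping.lookup c3 0) * of_nat (top_coeff u g e (v + s) p 0)"
    proof -
      have "top_coeff u g e (i + v + s) (j + p) k = 0" if "(i, j, k) \<noteq> 0" for i j k
        using top_coeff_degree[of u g e "i + v + s" "j + p" k] s that
        by (intro ccontr[of "_ = _"]) (auto simp: triple_eq_0_iff)
      then show ?thesis
        unfolding lin_ext_mult[of W c3] lin_ext_at_zero[symmetric]
        by (intro lin_ext_cong) (auto simp: mult_single W_def triple_eq_0_iff)
    qed
    ultimately have "Poly_Mapping.single 0 (Poly_Mapping.lookup c3 0)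
        * (of_nat (top_coeff u g e (v + s) p 0) :: 'a poly3) = 0"
      using dec by (simp add: lin_ext_add)
    moreover have "0 < top_coeff u g e (v + s) p 0"
      using s p_less pos by (intro top_coeff_pos) auto
    ultimately have "Poly_Mapping.lookup c3 0 * of_nat (top_coeff u g e (v + s) p 0) = 0"
      by (metis lookup_single_eq lookup_zero mult_single single_of_nat)
    then show ?thesis using \<open>0 < top_coeff u g e (v + s) p 0\<close> by simp
  qed
  \<comment> \<open>Cutting \<open>nf\<close> to degree \<open>d + 1\<close> avoids choosing
    \<open>c0\<close>, \<open>c3\<close> and \<open>r\<close> homogeneous; the generators of J are
    homogeneous, so it still respects them.\<close>
  define W :: "nat \<times> nat \<times> nat \<Rightarrow> 'a poly3"
    where "W = (\<lambda>(i, j, k). if i + j + k = Suc d then nf (i, j, k) else 0)"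
  have "lin_ext W r = 0"
  proof (rule lin_ext_J_eq_0[OF _ _ _ r])
    show "W (i, j + (u + g), k) = W (i + u, j, k + g)" for i j k
      unfolding W_def prod.case nf_y_power by (simp add: add_ac)
  qed (simp_all add: W_def nf_z_power nf_y_z_power)
  moreover have "lin_ext W (c0 * mon (u + v) 0 0) = 0"
  proof -
    have "i + (u + v) + j + k \<noteq> Suc d" for i j k using H1 d by arith
    then show ?thesis
      by - (rule lin_ext_mult_eq_0, simp add: mult_single split_paired_all W_def)
  qed
  moreover have "lin_ext W (c3 * mon v p 0) = 0"
  proof -
    \<comment> \<open>\<open>H2\<close> and \<open>d\<close> give \<open>d + 1 \<le> v + p\<close>,
      so only the constant term of \<open>c3\<close> can contribute.\<close>
    have "lin_ext W (c3 * mon v p 0) = lin_ext (\<lambda>m. if m = 0 then W (v, p, 0) else 0) c3"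
      unfolding lin_ext_mult[of W c3] using H2 d
      by (intro lin_ext_cong) (auto simp: mult_single W_def triple_eq_0_iff)
    then show ?thesis using c3 by (auto simp: lin_ext_at_zero W_def)
  qed
  ultimately have "lin_ext W (ell * f) = 0" using dec by (simp add: lin_ext_add)
  moreover have "lin_ext W (ell * f) = lin_ext nf (ell * f)"
    using homog_mult[OF homog_ell, of d f] f
    by (intro lin_ext_cong) (auto simp: W_def homog_def)
  ultimately have "ell * f \<in> ideal_gen J_gens" by (simp add: mem_J_iff)
  then show "f \<in> ideal_gen I_gens" using ell_nonzerodivisor J_subset_I by blast
qed

section \<open>The weak Lefschetz property and the original parameters\<close>

lemma has_WLP_I:
  assumes "p + g + e \<le> u + v + 1" "u + g + e \<le> v + p + 3"
  shows "has_WLP (ideal_gen (I_gens :: 'a::field_char_0 poly3 list))"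
  unfolding has_WLP_def
proof (intro exI conjI allI)
  show "homog 1 ell" by (rule homog_ell)
  show "mult_injective (ideal_gen (I_gens :: 'a poly3 list)) ell d
      \<or> mult_surjective (ideal_gen (I_gens :: 'a poly3 list)) ell d" for d
    using injective_I[OF assms] surjective_I[OF assms] not_less by blast
qed

end

theorem theorem3p4:
  fixes a b c \<beta> \<gamma> :: int
  assumes "a \<ge> c" "c \<ge> 2"
    and "1 \<le> \<beta>" "\<beta> \<le> b - 1"
    and "max 1 (b - a + 1) \<le> \<gamma>" "\<gamma> \<le> min (b - 1) (c - 1)"
    and "max 1 (b + c - a - 1) \<le> \<beta>"
    and "\<gamma> \<ge> (\<beta> - a + b + c - 2) div 2"
  shows "has_WLP (ideal_gen
           [(varX :: 'k::field_char_0 poly3) ^ nat a,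
            varY ^ nat b - varX ^ nat (b - \<gamma>) * varZ ^ nat \<gamma>,
            varZ ^ nat c,
            varX ^ nat (a - b + \<gamma>) * varY ^ nat (b - \<beta>),
            varY ^ nat (b - \<beta>) * varZ ^ nat (c - \<gamma>)])"
proof -
  define u v g e p where defs: "u = nat (b - \<gamma>)" "v = nat (a - b + \<gamma>)" "g = nat \<gamma>"
    "e = nat (c - \<gamma>)" "p = nat (b - \<beta>)"
  \<comment> \<open>The floor costs one. This bound becomes
    \<open>u + g + e \<le> v + p + 3\<close>, and \<open>b + c - a - 1 \<le> \<beta>\<close> becomes
    \<open>p + g + e \<le> u + v + 1\<close>.\<close>
  have "2 * \<gamma> \<ge> \<beta> - a + b + c - 3" using assms(8) by linarith
  then interpret exponents u v g e p
    using assms by unfold_locales (auto simp: defs)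
  have sums: "nat a = u + v" "nat b = u + g" "nat c = g + e"
    using assms by (auto simp: defs)
  have "has_WLP (ideal_gen (I_gens :: 'k poly3 list))"
    using assms \<open>2 * \<gamma> \<ge> \<beta> - a + b + c - 3\<close> by (intro has_WLP_I) (auto simp: defs)
  then show ?thesis
    unfolding sums defs(1-5)[symmetric] I_gens_def varX_power varY_power varZ_power
    by (simp add: mult_single)
qed

end
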